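(* Suppose $d=2$ and $D=\prod_{i=1}^\tau\Delta^{p_i}$ is a product of simplices, with $\eta=p_1+\cdots+p_\tau$, and let $f^k(x)=\sum_{i=1}^\tau\sum_{j=1}^{p_i}w^k_{i,j}x_{i,j}+b^k$ for $k\in\{1,2\}$. Write $z=z_1\equiv1-z_2$. For each $i\in\{1,\dots,\tau\}$ take $\widetilde w_{i,j}=w^1_{i,j}-w^2_{i,j}$ for $j=1,\dots,p_i$ and relabel the indices $j$ within each simplex so that $\widetilde w_{i,1}\le\cdots\le\widetilde w_{i,p_i}$. Then, for $(x,y,(z_1,z_2))\in D\times\mathbb{R}\times\Delta^2$, the constraints $$y\le\alpha\cdot x+\sum_{k=1}^2\left(\max_{x^k\in D}\{(w^k-\alpha)\cdot x^k\}+b^k\right)z_k\qquad\forall\alpha\in\mathbb{R}^\eta$$ are equivalent to $$y\le\sum_{i=1}^\tau\left(\widetilde w_{i,J(i)}z+\sum_{j=J(i)+1}^{p_i}(\widetilde w_{i,j}-\widetilde w_{i,J(i)})x_{i,j}+\sum_{j=1}^{p_i}w^2_{i,j}x_{i,j}\right)+(b^1-b^2)z+b^2\qquad(\ast)$$ for all mappings $J:\{1,\dots,\tau\}\to\mathbb{Z}$ with $J(i)\in\{1,\dots,p_i\}$ for all $i$. Moreover, given any point $(x,y,z)\in D\times\mathbb{R}\times[0,1]$, feasibility with respect to the family $(\ast)$ can be verified or a most violated constraint of $(\ast)$ can be found in $\mathcal{O}(p_1+\cdots+p_\tau)$ time.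
   Context: $\Delta^n=\{v\in\mathbb{R}^n_{\ge0}:\sum_iv_i=1\}$. Elements of $D=\prod_{i=1}^\tau\Delta^{p_i}$ are written $x=((x_{i,j})_{j=1}^{p_i})_{i=1}^\tau$ with $(x_{i,j})_{j=1}^{p_i}\in\Delta^{p_i}$ for each $i$, and vectors $w^k,\alpha\in\mathbb{R}^\eta$ are indexed in the same way. The weights are taken as already sorted (relabelled) as described when stating the running time. *)

theory Defs
  imports
    Complex_Main
    "HOL-Library.FuncSet"
    "HOL-Library.Landau_Symbols"
    "HOL-Library.More_List"
begin

definition std_simplex :: "nat \<Rightarrow> (nat \<Rightarrow> real) set" where
  "std_simplex n = {v \<in> {1..n} \<rightarrow>\<^sub>E UNIV. (\<forall>j\<in>{1..n}. 0 \<le> v j) \<and> (\<Sum>j=1..n. v j) = 1}"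

definition simplex_product :: "nat \<Rightarrow> (nat \<Rightarrow> nat) \<Rightarrow> (nat \<Rightarrow> nat \<Rightarrow> real) set" where
  "simplex_product \<tau> p = (\<Pi>\<^sub>E i\<in>{1..\<tau>}. std_simplex (p i))"

definition block_vectors :: "nat \<Rightarrow> (nat \<Rightarrow> nat) \<Rightarrow> (nat \<Rightarrow> nat \<Rightarrow> real) set" where
  "block_vectors \<tau> p = (\<Pi>\<^sub>E i\<in>{1..\<tau>}. {1..p i} \<rightarrow>\<^sub>E UNIV)"

definition block_inner ::
  "nat \<Rightarrow> (nat \<Rightarrow> nat) \<Rightarrow> (nat \<Rightarrow> nat \<Rightarrow> real) \<Rightarrow> (nat \<Rightarrow> nat \<Rightarrow> real) \<Rightarrow> real" where
  "block_inner \<tau> p u v = (\<Sum>i=1..\<tau>. \<Sum>j=1..p i. u i j * v i j)"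

definition max_over :: "('a \<Rightarrow> real) \<Rightarrow> 'a set \<Rightarrow> real" where
  "max_over g S = (GREATEST v. v \<in> g ` S)"

definition weight_diff :: "(nat \<Rightarrow> nat \<Rightarrow> nat \<Rightarrow> real) \<Rightarrow> nat \<Rightarrow> nat \<Rightarrow> real" where
  "weight_diff w i j = w 1 i j - w 2 i j"

definition weights_sorted ::
  "nat \<Rightarrow> (nat \<Rightarrow> nat) \<Rightarrow> (nat \<Rightarrow> nat \<Rightarrow> nat \<Rightarrow> real) \<Rightarrow> bool" where
  "weights_sorted \<tau> p w \<longleftrightarrow> (\<forall>i\<in>{1..\<tau>}. mono_on {1..p i} (weight_diff w i))"

definition selections :: "nat \<Rightarrow> (nat \<Rightarrow> nat) \<Rightarrow> (nat \<Rightarrow> nat) set" where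
  "selections \<tau> p = (\<Pi>\<^sub>E i\<in>{1..\<tau>}. {1..p i})"

definition dual_bound ::
  "nat \<Rightarrow> (nat \<Rightarrow> nat) \<Rightarrow> (nat \<Rightarrow> nat \<Rightarrow> nat \<Rightarrow> real) \<Rightarrow> (nat \<Rightarrow> real) \<Rightarrow>
   (nat \<Rightarrow> nat \<Rightarrow> real) \<Rightarrow> (nat \<Rightarrow> real) \<Rightarrow> (nat \<Rightarrow> nat \<Rightarrow> real) \<Rightarrow> real" where
  "dual_bound \<tau> p w b x z \<alpha> =
     block_inner \<tau> p \<alpha> x +
     (\<Sum>k=1..2. (max_over (block_inner \<tau> p (\<lambda>i j. w k i j - \<alpha> i j)) (simplex_product \<tau> p) + b k) * z k)"

definition selection_bound ::
  "nat \<Rightarrow> (nat \<Rightarrow> nat) \<Rightarrow> (nat \<Rightarrow> nat \<Rightarrow> nat \<Rightarrow> real) \<Rightarrow> (nat \<Rightarrow> real) \<Rightarrow>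
   (nat \<Rightarrow> nat \<Rightarrow> real) \<Rightarrow> real \<Rightarrow> (nat \<Rightarrow> nat) \<Rightarrow> real" where
  "selection_bound \<tau> p w b x z J =
     (\<Sum>i=1..\<tau>. weight_diff w i (J i) * z
        + (\<Sum>j=J i + 1..p i. (weight_diff w i j - weight_diff w i (J i)) * x i j)
        + (\<Sum>j=1..p i. w 2 i j * x i j))
     + (b 1 - b 2) * z + b 2"

text \<open>
  Running times refer to a real RAM, given as a while language. A store consists of numbered
  arrays of natural numbers and numbered arrays of reals. Array names are part of the program text,
  array indices are computed. Reals are exact; the only literals are integers, and there is no
  conversion between reals and naturals. Every literal, array access, arithmetic operation,
  comparison, connective, assignment and branch takes one unit of time.
\<close>

datatype nexp =
    NLit nat
  | NCell nat nexp
  | NAdd nexp nexp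
  | NSub nexp nexp

datatype rexp =
    RLit int
  | RCell nat nexp
  | RAdd rexp rexp
  | RSub rexp rexp
  | RMul rexp rexp

datatype bexp =
    NLess nexp nexp
  | RLess rexp rexp
  | BNot bexp
  | BAnd bexp bexp

datatype com =
    Skip
  | NStore nat nexp nexp
  | RStore nat nexp rexp
  | Seq com com
  | Cond bexp com com
  | Loop bexp com

type_synonym store = "(nat \<Rightarrow> nat \<Rightarrow> nat) \<times> (nat \<Rightarrow> nat \<Rightarrow> real)"

primrec nval :: "nexp \<Rightarrow> store \<Rightarrow> nat" where
  "nval (NLit n) s = n"
| "nval (NCell a e) s = fst s a (nval e s)"
| "nval (NAdd e e') s = nval e s + nval e' s"
| "nval (NSub e e') s = nval e s - nval e' s"

primrec rval :: "rexp \<Rightarrow> store \<Rightarrow> real" where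
  "rval (RLit c) s = of_int c"
| "rval (RCell a e) s = snd s a (nval e s)"
| "rval (RAdd e e') s = rval e s + rval e' s"
| "rval (RSub e e') s = rval e s - rval e' s"
| "rval (RMul e e') s = rval e s * rval e' s"

primrec bval :: "bexp \<Rightarrow> store \<Rightarrow> bool" where
  "bval (NLess e e') s \<longleftrightarrow> nval e s < nval e' s"
| "bval (RLess e e') s \<longleftrightarrow> rval e s < rval e' s"
| "bval (BNot c) s \<longleftrightarrow> \<not> bval c s"
| "bval (BAnd c c') s \<longleftrightarrow> bval c s \<and> bval c' s"

primrec ncost :: "nexp \<Rightarrow> nat" where
  "ncost (NLit n) = 1"
| "ncost (NCell a e) = ncost e + 1"
| "ncost (NAdd e e') = ncost e + ncost e' + 1"
| "ncost (NSub e e') = ncost e + ncost e' + 1"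

primrec rcost :: "rexp \<Rightarrow> nat" where
  "rcost (RLit c) = 1"
| "rcost (RCell a e) = ncost e + 1"
| "rcost (RAdd e e') = rcost e + rcost e' + 1"
| "rcost (RSub e e') = rcost e + rcost e' + 1"
| "rcost (RMul e e') = rcost e + rcost e' + 1"

primrec bcost :: "bexp \<Rightarrow> nat" where
  "bcost (NLess e e') = ncost e + ncost e' + 1"
| "bcost (RLess e e') = rcost e + rcost e' + 1"
| "bcost (BNot c) = bcost c + 1"
| "bcost (BAnd c c') = bcost c + bcost c' + 1"

text \<open>\<open>exec c s t s'\<close>: started in \<open>s\<close>, \<open>c\<close> terminates in \<open>s'\<close> after exactly \<open>t\<close> time units.\<close>

inductive exec :: "com \<Rightarrow> store \<Rightarrow> nat \<Rightarrow> store \<Rightarrow> bool" where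
  Skip: "exec Skip s 1 s"
| NStore: "exec (NStore a e e') (m, r) (ncost e + ncost e' + 1)
    (m(a := (m a)(nval e (m, r) := nval e' (m, r))), r)"
| RStore: "exec (RStore a e e') (m, r) (ncost e + rcost e' + 1)
    (m, r(a := (r a)(nval e (m, r) := rval e' (m, r))))"
| Seq: "exec c s t s' \<Longrightarrow> exec c' s' t' s'' \<Longrightarrow> exec (Seq c c') s (t + t') s''"
| CondTrue: "bval b s \<Longrightarrow> exec c s t s' \<Longrightarrow> exec (Cond b c c') s (bcost b + t + 1) s'"
| CondFalse: "\<not> bval b s \<Longrightarrow> exec c' s t s' \<Longrightarrow> exec (Cond b c c') s (bcost b + t + 1) s'"
| LoopFalse: "\<not> bval b s \<Longrightarrow> exec (Loop b c) s (bcost b + 1) s"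
| LoopTrue: "bval b s \<Longrightarrow> exec c s t s' \<Longrightarrow> exec (Loop b c) s' t' s'' \<Longrightarrow>
    exec (Loop b c) s (bcost b + t + t' + 1) s''"

inductive_cases exec_cases:
  "exec Skip s t s'"
  "exec (NStore a e e') s t s'"
  "exec (RStore a e e') s t s'"
  "exec (Seq c c') s t s'"
  "exec (Cond b c c') s t s'"
  "exec (Loop b c) s t s'"

lemma exec_deterministic:
  "exec c s t s' \<Longrightarrow> exec c s u s'' \<Longrightarrow> u = t \<and> s'' = s'"
proof (induction arbitrary: u s'' rule: exec.induct)
  case (Skip s)
  then show ?case by (auto elim: exec_cases)
next
  case NStore
  then show ?case by (auto elim: exec_cases)
next
  case RStore
  then show ?case by (auto elim: exec_cases)
next
  case Seq
  from Seq.prems show ?case by (rule exec_cases) (metis Seq.IH)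
next
  case CondTrue
  from CondTrue.prems show ?case by (rule exec_cases) (use CondTrue.IH CondTrue.hyps(1) in fastforce)+
next
  case CondFalse
  from CondFalse.prems show ?case by (rule exec_cases) (use CondFalse.IH CondFalse.hyps(1) in fastforce)+
next
  case LoopFalse
  from LoopFalse.prems show ?case by (rule exec_cases) (use LoopFalse.hyps(1) in auto)+
next
  case LoopTrue
  from LoopTrue.prems show ?case by (rule exec_cases) (use LoopTrue.IH LoopTrue.hyps(1) in fastforce)+
qed

definition flatten :: "nat \<Rightarrow> (nat \<Rightarrow> nat) \<Rightarrow> (nat \<Rightarrow> nat \<Rightarrow> real) \<Rightarrow> real list" where
  "flatten \<tau> p u = concat (map (\<lambda>i. map (u i) [1..<p i + 1]) [1..<\<tau> + 1])"

text \<open>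
  Input format, cells counted from 0 and all unmentioned cells being 0: the natural-number arrays 0
  and 1 hold \<open>\<tau>\<close> and the block sizes; the real arrays 0, 1, 2, 3 hold \<open>b\<^sup>1, b\<^sup>2, y, z\<close>, the weights
  \<open>w\<^sup>1\<close>, the weights \<open>w\<^sup>2\<close>, and the point \<open>x\<close>.
\<close>

definition input_store ::
  "nat \<Rightarrow> (nat \<Rightarrow> nat) \<Rightarrow> (nat \<Rightarrow> nat \<Rightarrow> nat \<Rightarrow> real) \<Rightarrow> (nat \<Rightarrow> real) \<Rightarrow>
   (nat \<Rightarrow> nat \<Rightarrow> real) \<Rightarrow> real \<Rightarrow> real \<Rightarrow> store" where
  "input_store \<tau> p w b x y z =
     (\<lambda>a. nth_default 0 (nth_default [] [[\<tau>], map p [1..<\<tau> + 1]] a),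
      \<lambda>a. nth_default 0
        (nth_default [] [[b 1, b 2, y, z], flatten \<tau> p (w 1), flatten \<tau> p (w 2), flatten \<tau> p x] a))"

text \<open>
  Output format: cell 0 of natural-number array 2 is 0 for the answer ``feasible'', and 1 for the
  answer ``violated'', in which case natural-number array 3 lists \<open>J 1, \<dots>, J \<tau>\<close>.
\<close>

definition output_violated :: "store \<Rightarrow> nat" where
  "output_violated s = fst s 2 0"

definition output_selection :: "nat \<Rightarrow> store \<Rightarrow> nat \<Rightarrow> nat" where
  "output_selection \<tau> s = (\<lambda>i\<in>{1..\<tau>}. fst s 3 (i - 1))"

definition most_violated ::
  "nat \<Rightarrow> (nat \<Rightarrow> nat) \<Rightarrow> (nat \<Rightarrow> nat \<Rightarrow> nat \<Rightarrow> real) \<Rightarrow> (nat \<Rightarrow> real) \<Rightarrow>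
   (nat \<Rightarrow> nat \<Rightarrow> real) \<Rightarrow> real \<Rightarrow> real \<Rightarrow> (nat \<Rightarrow> nat) \<Rightarrow> bool" where
  "most_violated \<tau> p w b x y z J \<longleftrightarrow>
     J \<in> selections \<tau> p \<and>
     y - selection_bound \<tau> p w b x z J > 0 \<and>
     (\<forall>J'\<in>selections \<tau> p.
        y - selection_bound \<tau> p w b x z J' \<le> y - selection_bound \<tau> p w b x z J)"

definition separation_answer ::
  "nat \<Rightarrow> (nat \<Rightarrow> nat) \<Rightarrow> (nat \<Rightarrow> nat \<Rightarrow> nat \<Rightarrow> real) \<Rightarrow> (nat \<Rightarrow> real) \<Rightarrow>
   (nat \<Rightarrow> nat \<Rightarrow> real) \<Rightarrow> real \<Rightarrow> real \<Rightarrow> store \<Rightarrow> bool" where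
  "separation_answer \<tau> p w b x y z s \<longleftrightarrow>
     output_violated s = 0 \<and> (\<forall>J\<in>selections \<tau> p. y \<le> selection_bound \<tau> p w b x z J) \<or>
     output_violated s = 1 \<and> most_violated \<tau> p w b x y z (output_selection \<tau> s)"

end

theory Submission imports Defs begin

text \<open>
  Both families separate over the simplices, so the argument concerns one simplex \<open>\<Delta>\<^sup>p\<close> with
  \<open>x \<in> \<Delta>\<^sup>p\<close>, \<open>u = w\<^sup>1\<close> and \<open>v = w\<^sup>2\<close>. Minimising the dual bound over \<open>\<alpha>\<close> is dual to the transportation
  problem of splitting \<open>x\<close> into parts of mass \<open>z\<close> and \<open>1 - z\<close> so as to maximise the resulting linear
  value. As \<open>u - v\<close> is sorted, filling the mass \<open>1 - z\<close> greedily from the left is optimal. Any split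
  bounds every dual value from below; conversely the selection bound of \<open>J\<close> is the dual value of
  \<open>\<alpha>\<^sub>j = v\<^sub>j + max 0 ((u\<^sub>j - v\<^sub>j) - (u\<^sub>J - v\<^sub>J))\<close>, and it equals the greedy value when \<open>J\<close> is the index at
  which the greedy filling stops. One left-to-right scan finds these indices and the minimal bound.
\<close>

section \<open>A single simplex\<close>

definition block_bound ::
  "nat \<Rightarrow> (nat \<Rightarrow> real) \<Rightarrow> (nat \<Rightarrow> real) \<Rightarrow> (nat \<Rightarrow> real) \<Rightarrow> real \<Rightarrow> nat \<Rightarrow> real" where
  "block_bound p u v x z J =
     (u J - v J) * z + (\<Sum>j=J+1..p. ((u j - v j) - (u J - v J)) * x j) + (\<Sum>j=1..p. v j * x j)"

text \<open>A linear function on a simplex is maximal at a vertex, hence the maxima over indices.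
  The constants \<open>b 1\<close>, \<open>b 2\<close> enter only once for the whole
  product.\<close>

definition block_dual ::
  "nat \<Rightarrow> (nat \<Rightarrow> real) \<Rightarrow> (nat \<Rightarrow> real) \<Rightarrow> (nat \<Rightarrow> real) \<Rightarrow> real \<Rightarrow> (nat \<Rightarrow> real) \<Rightarrow> real" where
  "block_dual p u v x z a =
     (\<Sum>j=1..p. a j * x j) + z * (MAX j\<in>{1..p}. u j - a j) + (1 - z) * (MAX j\<in>{1..p}. v j - a j)"

definition filled :: "(nat \<Rightarrow> real) \<Rightarrow> real \<Rightarrow> nat \<Rightarrow> real" where
  "filled x z m = min (1 - z) (\<Sum>j=1..m. x j)"

text \<open>
  The share of \<open>x j\<close> that goes to the second function when \<open>x\<close> is split as
  \<open>z x\<^sup>1 + (1 - z) x\<^sup>2\<close> and the mass \<open>1 - z\<close> is taken from the smallest indices.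
\<close>

definition share :: "(nat \<Rightarrow> real) \<Rightarrow> real \<Rightarrow> nat \<Rightarrow> real" where
  "share x z j = filled x z j - filled x z (j - 1)"

text \<open>Stated for a prefix of length \<open>m\<close>, so that it also describes the
  accumulator in the middle of a scan.\<close>

definition greedy_value ::
  "(nat \<Rightarrow> real) \<Rightarrow> (nat \<Rightarrow> real) \<Rightarrow> (nat \<Rightarrow> real) \<Rightarrow> real \<Rightarrow> nat \<Rightarrow> real" where
  "greedy_value u v x z m = (\<Sum>j=1..m. u j * (x j - share x z j) + v j * share x z j)"

text \<open>The index at which the quota \<open>1 - z\<close> is met. Both inequalities are weak, so
  ties may give several such indices, all with the same bound.\<close>

definition critical :: "nat \<Rightarrow> (nat \<Rightarrow> real) \<Rightarrow> real \<Rightarrow> nat \<Rightarrow> bool" where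
  "critical p x z J \<longleftrightarrow>
     J \<in> {1..p} \<and> (\<Sum>j=1..J - 1. x j) \<le> 1 - z \<and> 1 - z \<le> (\<Sum>j=1..J. x j)"

text \<open>
  What a left-to-right scan knows about its candidate \<open>J\<close> after \<open>m\<close> entries; \<open>J = m + 1\<close> means
  that the critical index has not been passed yet.
\<close>

definition critical_so_far :: "(nat \<Rightarrow> real) \<Rightarrow> real \<Rightarrow> nat \<Rightarrow> nat \<Rightarrow> bool" where
  "critical_so_far x z m J \<longleftrightarrow> 1 \<le> J \<and> J \<le> Suc m \<and>
     (J = 1 \<or> (\<Sum>j=1..J - 1. x j) < 1 - z) \<and> (J = Suc m \<or> 1 - z \<le> (\<Sum>j=1..J. x j))"

locale block =
  fixes p :: nat and u v x :: "nat \<Rightarrow> real" and z :: real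
  assumes sorted: "mono_on {1..p} (\<lambda>j. u j - v j)"
    and x_simplex: "x \<in> std_simplex p"
    and z_unit: "0 \<le> z" "z \<le> 1"
begin

lemma x_nonneg: "j \<in> {1..p} \<Longrightarrow> 0 \<le> x j"
  using x_simplex by (auto simp: std_simplex_def)

lemma x_sum: "(\<Sum>j=1..p. x j) = 1"
  using x_simplex by (auto simp: std_simplex_def)

lemma p_pos: "0 < p"
  using x_sum by (cases p) auto

lemma prefix_Suc: "j \<in> {1..p} \<Longrightarrow> (\<Sum>k=1..j. x k) = (\<Sum>k=1..j - 1. x k) + x j"
  by (cases j) auto

lemma prefix_mono: "m \<le> n \<Longrightarrow> n \<le> p \<Longrightarrow> (\<Sum>k=1..m. x k) \<le> (\<Sum>k=1..n. x k)"
  by (rule sum_mono2) (auto intro: x_nonneg)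

section \<open>The greedy split and duality\<close>

lemma share_nonneg: "j \<in> {1..p} \<Longrightarrow> 0 \<le> share x z j"
  using prefix_Suc[of j] x_nonneg[of j] by (auto simp: share_def filled_def)

lemma share_le: "j \<in> {1..p} \<Longrightarrow> share x z j \<le> x j"
  using prefix_Suc[of j] x_nonneg[of j] by (auto simp: share_def filled_def)

lemma sum_share: "(\<Sum>j=1..m. share x z j) = filled x z m"
proof (induction m)
  case 0
  then show ?case using z_unit by (simp add: filled_def)
next
  case (Suc m)
  then show ?case by (simp add: share_def)
qed

lemma sum_share_total: "(\<Sum>j=1..p. share x z j) = 1 - z"
  using sum_share[of p] z_unit unfolding filled_def x_sum by simp

text \<open>Weak duality: \<open>x j - share x z j\<close> and \<open>share x z j\<close> are
  nonnegative with total masses \<open>z\<close> and \<open>1 - z\<close>, so averaging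
  \<open>u j - a j\<close> and \<open>v j - a j\<close> with these weights stays below the two
  maxima.\<close>

lemma greedy_value_le_dual: "greedy_value u v x z p \<le> block_dual p u v x z a"
proof -
  define U where "U = (MAX j\<in>{1..p}. u j - a j)"
  define V where "V = (MAX j\<in>{1..p}. v j - a j)"
  have U: "u j - a j \<le> U" and V: "v j - a j \<le> V" if "j \<in> {1..p}" for j
    using that by (auto simp: U_def V_def)
  have "greedy_value u v x z p \<le>
      (\<Sum>j=1..p. a j * x j + (x j - share x z j) * U + share x z j * V)"
    unfolding greedy_value_def
  proof (rule sum_mono)
    fix j assume j: "j \<in> {1..p}"
    have "(x j - share x z j) * (u j - a j) \<le> (x j - share x z j) * U"
      using share_le[OF j] U[OF j] by (intro mult_left_mono) auto
    moreover have "share x z j * (v j - a j) \<le> share x z j * V"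
      using share_nonneg[OF j] V[OF j] by (intro mult_left_mono) auto
    ultimately show "u j * (x j - share x z j) + v j * share x z j
        \<le> a j * x j + (x j - share x z j) * U + share x z j * V"
      by (simp add: algebra_simps)
  qed
  also have "\<dots> = (\<Sum>j=1..p. a j * x j) + ((\<Sum>j=1..p. x j) - (\<Sum>j=1..p. share x z j)) * U
      + (\<Sum>j=1..p. share x z j) * V"
    by (simp only: sum.distrib sum_subtractf[symmetric] sum_distrib_right)
  also have "\<dots> = block_dual p u v x z a"
    using sum_share_total x_sum by (simp add: block_dual_def U_def V_def)
  finally show ?thesis .
qed

text \<open>For this vector the two maxima are at most \<open>u J - v J\<close> and 0. Sortedness
  makes the positive part vanish up to \<open>J\<close> and redundant beyond it, which leaves the
  sum from \<open>J+1\<close>.\<close>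

lemma dual_le_block_bound:
  assumes J: "J \<in> {1..p}"
  shows "block_dual p u v x z (\<lambda>j. v j + max 0 ((u j - v j) - (u J - v J))) \<le> block_bound p u v x z J"
proof -
  define a where "a = (\<lambda>j. v j + max 0 ((u j - v j) - (u J - v J)))"
  have "(MAX j\<in>{1..p}. u j - a j) \<le> u J - v J"
    using J by (subst Max_le_iff) (auto simp: a_def)
  then have 1: "z * (MAX j\<in>{1..p}. u j - a j) \<le> z * (u J - v J)"
    using z_unit by (intro mult_left_mono) auto
  have "(MAX j\<in>{1..p}. v j - a j) \<le> 0"
    using J by (subst Max_le_iff) (auto simp: a_def)
  then have 2: "(1 - z) * (MAX j\<in>{1..p}. v j - a j) \<le> 0"
    using z_unit by (intro mult_nonneg_nonpos) auto
  have "(\<Sum>j=1..p. a j * x j) =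
      (\<Sum>j=1..p. v j * x j) + (\<Sum>j=1..p. max 0 ((u j - v j) - (u J - v J)) * x j)"
    by (simp add: a_def distrib_right sum.distrib)
  also have "(\<Sum>j=1..p. max 0 ((u j - v j) - (u J - v J)) * x j) =
      (\<Sum>j=J+1..p. max 0 ((u j - v j) - (u J - v J)) * x j)"
  proof (rule sum.mono_neutral_right)
    show "\<forall>j\<in>{1..p} - {J+1..p}. max 0 ((u j - v j) - (u J - v J)) * x j = 0"
    proof
      fix j assume "j \<in> {1..p} - {J+1..p}"
      then have "u j - v j \<le> u J - v J"
        using J by (intro mono_onD[OF sorted]) auto
      then show "max 0 ((u j - v j) - (u J - v J)) * x j = 0"
        by simp
    qed
  qed (use J in auto)
  also have "\<dots> = (\<Sum>j=J+1..p. ((u j - v j) - (u J - v J)) * x j)"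
    using J mono_onD[OF sorted, of J]
    by (intro sum.cong) (auto simp: max_def)
  finally show ?thesis
    using 1 2 by (simp add: a_def[symmetric] block_dual_def block_bound_def mult.commute)
qed

lemma greedy_value_le_block_bound: "J \<in> {1..p} \<Longrightarrow> greedy_value u v x z p \<le> block_bound p u v x z J"
  using greedy_value_le_dual dual_le_block_bound by (rule order_trans)

text \<open>Complementary slackness: entries before \<open>J\<close> go entirely to the second
  function and entries after \<open>J\<close> entirely to the first.\<close>

lemma block_bound_critical:
  assumes "critical p x z J"
  shows "block_bound p u v x z J = greedy_value u v x z p"
proof -
  define c where "c = u J - v J"
  have J: "J \<in> {1..p}" and lo: "(\<Sum>j=1..J - 1. x j) \<le> 1 - z" and hi: "1 - z \<le> (\<Sum>j=1..J. x j)"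
    using assms by (auto simp: critical_def)
  have below: "x j - share x z j = 0" if j: "j \<in> {1..p}" "j < J" for j
  proof -
    have "j \<le> J - 1" "j - 1 \<le> J - 1" "J - 1 \<le> p" using j J by auto
    then have "(\<Sum>k=1..j. x k) \<le> 1 - z" "(\<Sum>k=1..j - 1. x k) \<le> 1 - z"
      using prefix_mono lo by (meson order_trans)+
    then show ?thesis using prefix_Suc[OF j(1)] by (simp add: share_def filled_def)
  qed
  have above: "share x z j = 0" if j: "j \<in> {1..p}" "J < j" for j
  proof -
    have "J \<le> j" "J \<le> j - 1" "j \<le> p" "j - 1 \<le> p" using j by auto
    then have "1 - z \<le> (\<Sum>k=1..j. x k)" "1 - z \<le> (\<Sum>k=1..j - 1. x k)"
      using prefix_mono hi by (meson order_trans)+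
    then show ?thesis by (simp add: share_def filled_def)
  qed
  \<comment> \<open>The parts \<open>x j - share x z j\<close> have total mass \<open>z\<close>;
    subtracting \<open>c\<close> times that mass makes the summand at \<open>J\<close>
    vanish.\<close>
  have "greedy_value u v x z p - (\<Sum>j=1..p. v j * x j) - c * z =
      (\<Sum>j=1..p. u j * (x j - share x z j) + v j * share x z j) - (\<Sum>j=1..p. v j * x j)
      - c * ((\<Sum>j=1..p. x j) - (\<Sum>j=1..p. share x z j))"
    using sum_share_total x_sum by (simp add: greedy_value_def)
  also have "\<dots> = (\<Sum>j=1..p. ((u j - v j) - c) * (x j - share x z j))"
    by (simp add: sum_subtractf[symmetric] sum_distrib_left sum.distrib[symmetric] algebra_simps)
  also have "\<dots> = (\<Sum>j=J+1..p. ((u j - v j) - c) * (x j - share x z j))"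
  proof (rule sum.mono_neutral_right)
    show "\<forall>j\<in>{1..p} - {J+1..p}. ((u j - v j) - c) * (x j - share x z j) = 0"
    proof
      fix j assume "j \<in> {1..p} - {J+1..p}"
      then have "j \<in> {1..p}" "j < J \<or> j = J" by auto
      then show "((u j - v j) - c) * (x j - share x z j) = 0"
        using below[of j] by (auto simp: c_def)
    qed
  qed (use J in auto)
  also have "\<dots> = (\<Sum>j=J+1..p. ((u j - v j) - c) * x j)"
    using above J by (intro sum.cong) auto
  finally show ?thesis by (simp add: block_bound_def c_def)
qed

lemma critical_exists: "\<exists>J. critical p x z J"
proof -
  \<comment> \<open>For \<open>z = 1\<close> the empty prefix already meets the quota 0; the guard
    \<open>1 \<le> m\<close> keeps \<open>J\<close> an index.\<close>
  define J where "J = (LEAST m. 1 \<le> m \<and> 1 - z \<le> (\<Sum>j=1..m. x j))"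
  have p: "1 \<le> p \<and> 1 - z \<le> (\<Sum>j=1..p. x j)" using p_pos z_unit x_sum by auto
  have J: "1 \<le> J \<and> 1 - z \<le> (\<Sum>j=1..J. x j)" unfolding J_def using p by (rule LeastI)
  have "J \<le> p" unfolding J_def using p by (rule Least_le)
  moreover have "(\<Sum>j=1..J - 1. x j) \<le> 1 - z"
  proof (cases "J = 1")
    case True
    then show ?thesis using z_unit by simp
  next
    case False
    then have "\<not> (1 \<le> J - 1 \<and> 1 - z \<le> (\<Sum>j=1..J - 1. x j))"
      using J not_less_Least[of "J - 1" "\<lambda>m. 1 \<le> m \<and> 1 - z \<le> (\<Sum>j=1..m. x j)"]
      unfolding J_def[symmetric] by linarith
    then show ?thesis using False J by auto
  qed
  ultimately show ?thesis using J by (auto simp: critical_def)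
qed

section \<open>The greedy filling as a left-to-right recursion\<close>

lemma filled_Suc:
  assumes "j < p"
  shows "filled x z (Suc j) = (if x (Suc j) < 1 - z - filled x z j then filled x z j + x (Suc j) else 1 - z)"
  using x_nonneg[of "Suc j"] assms by (auto simp: filled_def min_def)

text \<open>If the quota survives entry \<open>j + 1\<close>, the candidate moves to the next entry,
  \<open>j + 2\<close>. Otherwise it was fixed earlier or is \<open>j + 1\<close> itself, and
  stays.\<close>

lemma critical_so_far_Suc:
  assumes "j < p" "critical_so_far x z j J"
  shows "critical_so_far x z (Suc j) (if x (Suc j) < 1 - z - filled x z j then j + 2 else J)"
  using x_nonneg[of "Suc j"] assms by (auto simp: filled_def min_def critical_so_far_def split: if_splits)

text \<open>The candidate cannot have run past the end, since the full mass 1 is at least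
  \<open>1 - z\<close>.\<close>

lemma critical_so_far_all: "critical_so_far x z p J \<Longrightarrow> critical p x z J"
  using x_sum z_unit p_pos by (auto simp: critical_so_far_def critical_def le_Suc_eq)

end

section \<open>Products of simplices\<close>

lemma unit_vector_simplex:
  assumes "j \<in> {1..n}"
  shows "(\<lambda>k\<in>{1..n}. if k = j then 1 else 0) \<in> std_simplex n"
proof -
  have "(\<Sum>k=1..n. (\<lambda>k\<in>{1..n}. if k = j then 1 else 0) k) = (\<Sum>k=1..n. if k = j then 1 else (0::real))"
    by (intro sum.cong) auto
  then show ?thesis using assms by (auto simp: std_simplex_def)
qed

text \<open>Blocks are maximised independently: a vertex with the best index in each block attains
  the sum, and a convex combination never exceeds its largest entry. Attainment matters because
  \<open>max_over\<close> is a \<open>GREATEST\<close>.\<close>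

lemma max_over_block_inner:
  assumes p: "\<And>i. i \<in> {1..\<tau>} \<Longrightarrow> 0 < p i"
  shows "max_over (block_inner \<tau> p c) (simplex_product \<tau> p) = (\<Sum>i=1..\<tau>. MAX j\<in>{1..p i}. c i j)"
proof -
  have "\<exists>j\<in>{1..p i}. c i j = (MAX j\<in>{1..p i}. c i j)" if "i \<in> {1..\<tau>}" for i
    using Max_in[of "c i ` {1..p i}"] p[OF that] by (fastforce simp del: Max_in)
  then obtain J where J: "\<And>i. i \<in> {1..\<tau>} \<Longrightarrow> J i \<in> {1..p i} \<and> c i (J i) = (MAX j\<in>{1..p i}. c i j)"
    by metis
  define e where "e = (\<lambda>i\<in>{1..\<tau>}. \<lambda>k\<in>{1..p i}. if k = J i then 1 else (0::real))"
  have e: "e \<in> simplex_product \<tau> p"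
    using unit_vector_simplex J by (auto simp: e_def simplex_product_def)
  have "block_inner \<tau> p c e = (\<Sum>i=1..\<tau>. MAX j\<in>{1..p i}. c i j)"
    unfolding block_inner_def
  proof (rule sum.cong)
    fix i assume i: "i \<in> {1..\<tau>}"
    have "(\<Sum>j=1..p i. c i j * e i j) = (\<Sum>j=1..p i. if j = J i then c i j else 0)"
      using i by (intro sum.cong) (auto simp: e_def)
    then show "(\<Sum>j=1..p i. c i j * e i j) = (MAX j\<in>{1..p i}. c i j)"
      using J[OF i] by auto
  qed simp
  moreover have "block_inner \<tau> p c x \<le> (\<Sum>i=1..\<tau>. MAX j\<in>{1..p i}. c i j)"
    if x: "x \<in> simplex_product \<tau> p" for x
    unfolding block_inner_def
  proof (rule sum_mono)
    fix i assume i: "i \<in> {1..\<tau>}"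
    have xi: "x i \<in> std_simplex (p i)" using x i by (auto simp: simplex_product_def)
    have "(\<Sum>j=1..p i. c i j * x i j) \<le> (\<Sum>j=1..p i. (MAX j\<in>{1..p i}. c i j) * x i j)"
      using xi by (intro sum_mono mult_right_mono) (auto simp: std_simplex_def)
    also have "\<dots> = (MAX j\<in>{1..p i}. c i j)"
      using xi by (simp add: sum_distrib_left[symmetric] std_simplex_def)
    finally show "(\<Sum>j=1..p i. c i j * x i j) \<le> (MAX j\<in>{1..p i}. c i j)" .
  qed
  ultimately show ?thesis
    unfolding max_over_def using e by (intro Greatest_equality) (auto simp: image_iff, metis)
qed

lemma simplex_product_block:
  assumes "weights_sorted \<tau> p w" "x \<in> simplex_product \<tau> p" "z \<in> {0..1}" "i \<in> {1..\<tau>}"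
  shows "block (p i) (w 1 i) (w 2 i) (x i) z"
  using assms by unfold_locales
    (auto simp: weights_sorted_def simplex_product_def weight_diff_def[abs_def])

lemma selection_bound_blocks:
  "selection_bound \<tau> p w b x z J =
     (\<Sum>i=1..\<tau>. block_bound (p i) (w 1 i) (w 2 i) (x i) z (J i)) + (b 1 - b 2) * z + b 2"
  by (simp add: selection_bound_def block_bound_def weight_diff_def)

lemma dual_bound_blocks:
  assumes p: "\<And>i. i \<in> {1..\<tau>} \<Longrightarrow> 0 < p i" and z: "z 1 + z 2 = 1"
  shows "dual_bound \<tau> p w b x z \<alpha> =
     (\<Sum>i=1..\<tau>. block_dual (p i) (w 1 i) (w 2 i) (x i) (z 1) (\<alpha> i)) + (b 1 - b 2) * z 1 + b 2"
proof -
  have z2: "z 2 = 1 - z 1" using z by simp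
  have max: "max_over (block_inner \<tau> p c) (simplex_product \<tau> p) =
      (\<Sum>i=1..\<tau>. MAX j\<in>{1..p i}. c i j)" for c
    using p by (rule max_over_block_inner)
  have "{1..2} = {1, 2::nat}" by auto
  then show ?thesis
    by (simp add: dual_bound_def max block_dual_def block_inner_def z2
        sum.distrib sum_distrib_left[symmetric] sum_subtractf
        left_diff_distrib right_diff_distrib distrib_right)
qed

text \<open>Each selection inequality follows from one particular dual vector. Conversely, the
  selection of critical indices, which does not depend on \<open>\<alpha>\<close>, lies below every
  dual bound.\<close>

lemma dual_iff_selections:
  assumes srt: "weights_sorted \<tau> p w" and x: "x \<in> simplex_product \<tau> p" and z: "z \<in> std_simplex 2"
  shows "(\<forall>\<alpha>\<in>block_vectors \<tau> p. y \<le> dual_bound \<tau> p w b x z \<alpha>) \<longleftrightarrow>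
    (\<forall>J\<in>selections \<tau> p. y \<le> selection_bound \<tau> p w b x (z 1) J)"
proof -
  have "{1..2} = {1, 2::nat}" by auto
  then have z': "z 1 + z 2 = 1" "z 1 \<in> {0..1}" using z by (auto simp: std_simplex_def)
  note blk = simplex_product_block[OF srt x z'(2)]
  have db: "dual_bound \<tau> p w b x z \<alpha> =
      (\<Sum>i=1..\<tau>. block_dual (p i) (w 1 i) (w 2 i) (x i) (z 1) (\<alpha> i)) + (b 1 - b 2) * z 1 + b 2" for \<alpha>
    using block.p_pos[OF blk] z'(1) by (rule dual_bound_blocks)
  show ?thesis
  proof (intro iffI ballI)
    fix J assume *: "\<forall>\<alpha>\<in>block_vectors \<tau> p. y \<le> dual_bound \<tau> p w b x z \<alpha>" and J: "J \<in> selections \<tau> p"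
    define a where "a i j = w 2 i j + max 0 ((w 1 i j - w 2 i j) - (w 1 i (J i) - w 2 i (J i)))" for i j
    \<comment> \<open>\<open>block_vectors\<close> is extensional, so \<open>a\<close> is cut down
      to the index ranges, to which the sums and maxima are confined.\<close>
    define \<alpha> where "\<alpha> = (\<lambda>i\<in>{1..\<tau>}. \<lambda>j\<in>{1..p i}. a i j)"
    have "\<alpha> \<in> block_vectors \<tau> p" by (auto simp: \<alpha>_def block_vectors_def)
    with * have "y \<le> dual_bound \<tau> p w b x z \<alpha>" by blast
    also have "\<dots> \<le> selection_bound \<tau> p w b x (z 1) J"
      unfolding db selection_bound_blocks
    proof (intro add_right_mono sum_mono)
      fix i assume i: "i \<in> {1..\<tau>}"
      have "block_dual (p i) (w 1 i) (w 2 i) (x i) (z 1) (\<alpha> i) =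
          block_dual (p i) (w 1 i) (w 2 i) (x i) (z 1) (a i)"
        using i unfolding block_dual_def
        by (intro arg_cong2[where f = "(+)"] arg_cong2[where f = "(*)"] arg_cong[where f = Max]
            sum.cong image_cong) (auto simp: \<alpha>_def)
      also have "\<dots> \<le> block_bound (p i) (w 1 i) (w 2 i) (x i) (z 1) (J i)"
        unfolding a_def using J i by (intro block.dual_le_block_bound[OF blk[OF i]])
          (auto simp: selections_def)
      finally show "block_dual (p i) (w 1 i) (w 2 i) (x i) (z 1) (\<alpha> i) \<le>
        block_bound (p i) (w 1 i) (w 2 i) (x i) (z 1) (J i)" .
    qed
    finally show "y \<le> selection_bound \<tau> p w b x (z 1) J" .
  next
    fix \<alpha> assume *: "\<forall>J\<in>selections \<tau> p. y \<le> selection_bound \<tau> p w b x (z 1) J"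
      and "\<alpha> \<in> block_vectors \<tau> p"
    obtain K where K: "\<And>i. i \<in> {1..\<tau>} \<Longrightarrow> critical (p i) (x i) (z 1) (K i)"
      using block.critical_exists[OF blk] by metis
    define J where "J = restrict K {1..\<tau>}"
    have "J \<in> selections \<tau> p" using K by (auto simp: J_def selections_def critical_def)
    with * have "y \<le> selection_bound \<tau> p w b x (z 1) J" by blast
    also have "\<dots> \<le> dual_bound \<tau> p w b x z \<alpha>"
      unfolding db selection_bound_blocks
    proof (intro add_right_mono sum_mono)
      fix i assume i: "i \<in> {1..\<tau>}"
      show "block_bound (p i) (w 1 i) (w 2 i) (x i) (z 1) (J i) \<le>
          block_dual (p i) (w 1 i) (w 2 i) (x i) (z 1) (\<alpha> i)"
        using block.block_bound_critical[OF blk[OF i] K[OF i]]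
          block.greedy_value_le_dual[OF blk[OF i], of "\<alpha> i"] i by (simp add: J_def)
    qed
    finally show "y \<le> dual_bound \<tau> p w b x z \<alpha>" .
  qed
qed

section \<open>Running programs\<close>

text \<open>A timed weakest precondition; its equations below let the simplifier execute loop-free
  code symbolically.\<close>

definition runs :: "com \<Rightarrow> store \<Rightarrow> (nat \<Rightarrow> store \<Rightarrow> bool) \<Rightarrow> bool" where
  "runs c s Q \<longleftrightarrow> (\<exists>t s'. exec c s t s' \<and> Q t s')"

lemma runs_mono: "runs c s Q \<Longrightarrow> (\<And>t s'. Q t s' \<Longrightarrow> R t s') \<Longrightarrow> runs c s R"
  unfolding runs_def by blast

lemma runs_Skip: "runs Skip s Q \<longleftrightarrow> Q 1 s"
  unfolding runs_def using exec.Skip[of s] by (auto simp del: split_paired_Ex elim: exec_cases)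

lemma runs_NStore:
  "runs (NStore a e e') s Q \<longleftrightarrow>
    Q (ncost e + ncost e' + 1) ((fst s)(a := (fst s a)(nval e s := nval e' s)), snd s)"
  unfolding runs_def using exec.NStore[of a e e' "fst s" "snd s"] by (auto elim: exec_cases)

lemma runs_RStore:
  "runs (RStore a e e') s Q \<longleftrightarrow>
    Q (ncost e + rcost e' + 1) (fst s, (snd s)(a := (snd s a)(nval e s := rval e' s)))"
  unfolding runs_def using exec.RStore[of a e e' "fst s" "snd s"] by (auto elim: exec_cases)

lemma runs_Seq: "runs (Seq c c') s Q \<longleftrightarrow> runs c s (\<lambda>t s'. runs c' s' (\<lambda>t' s''. Q (t + t') s''))"
  unfolding runs_def by (blast intro: exec.Seq elim: exec_cases)

lemma runs_Cond:
  "runs (Cond b c c') s Q \<longleftrightarrow> runs (if bval b s then c else c') s (\<lambda>t s'. Q (bcost b + t + 1) s')"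
proof
  assume "runs (Cond b c c') s Q"
  then show "runs (if bval b s then c else c') s (\<lambda>t s'. Q (bcost b + t + 1) s')"
    unfolding runs_def by (auto simp del: split_paired_Ex elim!: exec_cases)
next
  assume "runs (if bval b s then c else c') s (\<lambda>t s'. Q (bcost b + t + 1) s')"
  then obtain t s' where *: "exec (if bval b s then c else c') s t s'" "Q (bcost b + t + 1) s'"
    unfolding runs_def by blast
  have "exec (Cond b c c') s (bcost b + t + 1) s'"
    using *(1) by (cases "bval b s")
      (simp_all only: if_True if_False exec.CondTrue exec.CondFalse not_False_eq_True)
  with *(2) show "runs (Cond b c c') s Q" unfolding runs_def by blast
qed

lemmas runs_simps = runs_Skip runs_NStore runs_RStore runs_Seq runs_Cond

text \<open>The potential \<open>V\<close> pays for every iteration, so it bounds the total time of the loop.\<close>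

lemma runs_Loop:
  assumes inv: "I s"
    and step: "\<And>s. I s \<Longrightarrow> bval b s \<Longrightarrow>
      runs c s (\<lambda>t s'. I s' \<and> V s' + t + bcost b + 1 \<le> V s)"
  shows "runs (Loop b c) s (\<lambda>t s'. I s' \<and> \<not> bval b s' \<and> t \<le> V s + bcost b + 1)"
  using inv
\<comment> \<open>An iteration costs at least 1, so the potential is a termination measure as
  well.\<close>
proof (induction "V s" arbitrary: s rule: less_induct)
  case less
  show ?case
  proof (cases "bval b s")
    case True
    obtain t s' where body: "exec c s t s'" "I s'" "V s' + t + bcost b + 1 \<le> V s"
      using step[OF less.prems True] unfolding runs_def by blast
    obtain t' s'' where rest: "exec (Loop b c) s' t' s''" "I s''" "\<not> bval b s''"
        "t' \<le> V s' + bcost b + 1"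
      using less.hyps[of s'] body unfolding runs_def by auto
    have "exec (Loop b c) s (bcost b + t + t' + 1) s''"
      using True body(1) rest(1) by (rule exec.LoopTrue)
    moreover have "bcost b + t + t' + 1 \<le> V s + bcost b + 1" using body(3) rest(4) by simp
    ultimately show ?thesis unfolding runs_def using rest by blast
  next
    case False
    then show ?thesis unfolding runs_def using less.prems exec.LoopFalse by fastforce
  qed
qed

section \<open>The separation program\<close>

lemma flatten_Suc: "flatten (Suc n) p u = flatten n p u @ map (u (Suc n)) [1..<p (Suc n) + 1]"
  by (simp add: flatten_def)

lemma length_flatten: "length (flatten n p u) = (\<Sum>k=1..n. p k)"
  by (induction n) (simp_all add: flatten_Suc, simp add: flatten_def)

lemma offset_less:
  assumes "i < n" "j < p (Suc i)"
  shows "(\<Sum>k=1..i. p k) + j < (\<Sum>k=1..n. p k :: nat)"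
proof -
  have "(\<Sum>k=1..i. p k) + j < (\<Sum>k=1..Suc i. p k)" using assms by simp
  also have "\<dots> \<le> (\<Sum>k=1..n. p k)" using assms by (intro sum_mono2) auto
  finally show ?thesis .
qed

text \<open>Addresses count from 0 but blocks and entries from 1, hence the two \<open>Suc\<close>.
  Appending a block leaves the addresses of the earlier ones unchanged.\<close>

lemma nth_flatten:
  "i < n \<Longrightarrow> j < p (Suc i) \<Longrightarrow>
    nth_default 0 (flatten n p u) ((\<Sum>k=1..i. p k) + j) = u (Suc i) (Suc j)"
proof (induction n)
  case 0
  then show ?case by simp
next
  case (Suc n)
  show ?case
  proof (cases "i < n")
    case True
    then have "(\<Sum>k=1..i. p k) + j < length (flatten n p u)"
      using offset_less[of i n j p] Suc.prems by (simp add: length_flatten)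
    then show ?thesis
      using Suc.IH[OF True Suc.prems(2)] unfolding flatten_Suc
      by (simp only: nth_default_append nth_default_nth if_True)
  next
    case False
    then have "i = n" using Suc.prems by simp
    then show ?thesis
      using Suc.prems
      by (simp add: flatten_Suc nth_default_append nth_default_def length_flatten nth_append
          del: upt_Suc)
  qed
qed

text \<open>
  Working cells: the block \<open>i\<close>, the entry \<open>j\<close> within it and the position \<open>pos\<close> in the flattened input, all
  counted from 0; the optimal value \<open>acc\<close> of the blocks read so far; and the part \<open>rest\<close> of the mass
  \<open>1 - z\<close> that is still to be taken from the current block.
\<close>

abbreviation "i_cell \<equiv> NCell 4 (NLit 0)"
abbreviation "j_cell \<equiv> NCell 5 (NLit 0)"
abbreviation "pos_cell \<equiv> NCell 6 (NLit 0)"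
abbreviation "acc_cell \<equiv> RCell 4 (NLit 0)"
abbreviation "rest_cell \<equiv> RCell 5 (NLit 0)"
abbreviation "z_cell \<equiv> RCell 0 (NLit 3)"

abbreviation "blocks_left \<equiv> NLess i_cell (NCell 0 (NLit 0))"

text \<open>The whole entry goes to the second function. As \<open>j\<close> counts from 0 and
  selections from 1, the next entry is \<open>j + 2\<close>.\<close>

definition take_all :: com where
  "take_all =
     Seq (NStore 3 i_cell (NAdd j_cell (NLit 2)))
    (Seq (RStore 4 (NLit 0) (RAdd acc_cell (RMul (RCell 2 pos_cell) (RCell 3 pos_cell))))
         (RStore 5 (NLit 0) (RSub rest_cell (RCell 3 pos_cell))))"

text \<open>Splits the entry and sets the quota to 0. Later entries of the block, not being below 0,
  take this branch again and go to the first function; the candidate stays.\<close>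

definition take_rest :: com where
  "take_rest =
     Seq (RStore 4 (NLit 0) (RAdd acc_cell
           (RAdd (RMul (RCell 1 pos_cell) (RSub (RCell 3 pos_cell) rest_cell))
                 (RMul (RCell 2 pos_cell) rest_cell))))
         (RStore 5 (NLit 0) (RLit 0))"

text \<open>One loop instead of two nested ones: an iteration reads an entry or moves to the next
  block. Leaving the last block writes cell \<open>\<tau>\<close> of array 3, which lies outside the
  output.\<close>

definition scan_body :: com where
  "scan_body =
     Cond (NLess j_cell (NCell 1 i_cell))
       (Seq (Cond (RLess (RCell 3 pos_cell) rest_cell) take_all take_rest)
       (Seq (NStore 5 (NLit 0) (NAdd j_cell (NLit 1)))
            (NStore 6 (NLit 0) (NAdd pos_cell (NLit 1)))))
       (Seq (NStore 4 (NLit 0) (NAdd i_cell (NLit 1)))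
       (Seq (NStore 5 (NLit 0) (NLit 0))
       (Seq (NStore 3 i_cell (NLit 1))
            (RStore 5 (NLit 0) (RSub (RLit 1) z_cell)))))"

definition report :: com where
  "report =
     Cond (RLess (RAdd acc_cell
             (RAdd (RMul (RSub (RCell 0 (NLit 0)) (RCell 0 (NLit 1))) z_cell) (RCell 0 (NLit 1))))
           (RCell 0 (NLit 2)))
       (NStore 2 (NLit 0) (NLit 1))
       Skip"

definition separation_program :: com where
  "separation_program =
     Seq (NStore 3 (NLit 0) (NLit 1))
    (Seq (RStore 5 (NLit 0) (RSub (RLit 1) z_cell))
    (Seq (Loop blocks_left scan_body) report))"

section \<open>Loop invariant, correctness and running time\<close>

locale separation =
  fixes \<tau> :: nat and p :: "nat \<Rightarrow> nat" and w :: "nat \<Rightarrow> nat \<Rightarrow> nat \<Rightarrow> real" and b :: "nat \<Rightarrow> real"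
    and x :: "nat \<Rightarrow> nat \<Rightarrow> real" and y z :: real
  assumes srt: "weights_sorted \<tau> p w" and x_mem: "x \<in> simplex_product \<tau> p" and z_mem: "z \<in> {0..1}"
begin

lemma blk: "i \<in> {1..\<tau>} \<Longrightarrow> block (p i) (w 1 i) (w 2 i) (x i) z"
  using srt x_mem z_mem by (rule simplex_product_block)

definition offset :: "nat \<Rightarrow> nat" where
  "offset i = (\<Sum>k=1..i. p k)"

definition input_kept :: "store \<Rightarrow> bool" where
  "input_kept s \<longleftrightarrow>
     fst s 0 0 = \<tau> \<and> (\<forall>i<\<tau>. fst s 1 i = p (Suc i)) \<and>
     snd s 0 0 = b 1 \<and> snd s 0 1 = b 2 \<and> snd s 0 2 = y \<and> snd s 0 3 = z \<and>
     (\<forall>i<\<tau>. \<forall>j<p (Suc i). snd s 1 (offset i + j) = w 1 (Suc i) (Suc j) \<and>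
        snd s 2 (offset i + j) = w 2 (Suc i) (Suc j) \<and> snd s 3 (offset i + j) = x (Suc i) (Suc j))"

definition block_value :: "nat \<Rightarrow> nat \<Rightarrow> real" where
  "block_value i m = greedy_value (w 1 i) (w 2 i) (x i) z m"

text \<open>At \<open>i = \<tau>\<close> there is no block \<open>Suc i\<close>; with
  \<open>j = 0\<close> its value and its filled mass are 0, and its candidate is just 1.\<close>

definition scanned :: "nat \<Rightarrow> nat \<Rightarrow> store \<Rightarrow> bool" where
  "scanned i j s \<longleftrightarrow> input_kept s \<and> i \<le> \<tau> \<and> (if i < \<tau> then j \<le> p (Suc i) else j = 0) \<and>
     fst s 4 0 = i \<and> fst s 5 0 = j \<and> fst s 6 0 = offset i + j \<and> fst s 2 0 = 0 \<and>
     snd s 4 0 = (\<Sum>k=1..i. block_value k (p k)) + block_value (Suc i) j \<and>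
     snd s 5 0 = 1 - z - filled (x (Suc i)) z j \<and>
     (\<forall>k<i. critical (p (Suc k)) (x (Suc k)) z (fst s 3 k)) \<and>
     critical_so_far (x (Suc i)) z j (fst s 3 i)"

text \<open>Blocks still to be left plus entries still to be read count the remaining iterations;
  100 covers the body and the loop test.\<close>

definition potential :: "store \<Rightarrow> nat" where
  "potential s = 100 * ((\<tau> - fst s 4 0) + (offset \<tau> - fst s 6 0))"

lemma block_value_Suc:
  assumes "i < \<tau>" "j < p (Suc i)"
  shows "block_value (Suc i) (Suc j) = block_value (Suc i) j +
    (let r = 1 - z - filled (x (Suc i)) z j; a = x (Suc i) (Suc j) in
     if a < r then w 2 (Suc i) (Suc j) * a
     else w 1 (Suc i) (Suc j) * (a - r) + w 2 (Suc i) (Suc j) * r)"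
  using block.filled_Suc[OF blk, of "Suc i" j] assms
  by (auto simp: block_value_def greedy_value_def share_def Let_def)

lemma scan_entry:
  assumes s: "scanned i j s" and i: "i < \<tau>" and j: "j < p (Suc i)"
  shows "runs scan_body s (\<lambda>t s'. t \<le> 90 \<and> scanned i (Suc j) s')"
proof -
  define r where "r = 1 - z - filled (x (Suc i)) z j"
  have blk': "block (p (Suc i)) (w 1 (Suc i)) (w 2 (Suc i)) (x (Suc i)) z"
    using i by (intro blk) auto
  have csf: "critical_so_far (x (Suc i)) z (Suc j) (if x (Suc i) (Suc j) < r then j + 2 else fst s 3 i)"
    using block.critical_so_far_Suc[OF blk' j] s by (simp add: scanned_def r_def)
  have fill: "1 - z - filled (x (Suc i)) z (Suc j) =
      (if x (Suc i) (Suc j) < r then r - x (Suc i) (Suc j) else 0)"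
    using block.filled_Suc[OF blk' j] by (simp add: r_def)
  have val: "block_value (Suc i) (Suc j) = block_value (Suc i) j +
      (if x (Suc i) (Suc j) < r then w 2 (Suc i) (Suc j) * x (Suc i) (Suc j)
       else w 1 (Suc i) (Suc j) * (x (Suc i) (Suc j) - r) + w 2 (Suc i) (Suc j) * r)"
    using block_value_Suc[OF i j] by (simp add: r_def Let_def)
  have st: "fst s 4 0 = i" "fst s 5 0 = j" "fst s 6 0 = offset i + j" "snd s 5 0 = r"
    "fst s (Suc 0) i = p (Suc i)" "snd s (Suc 0) (offset i + j) = w 1 (Suc i) (Suc j)"
    "snd s 2 (offset i + j) = w 2 (Suc i) (Suc j)" "snd s 3 (offset i + j) = x (Suc i) (Suc j)"
    using s i j by (auto simp: scanned_def input_kept_def r_def)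
  \<comment> \<open>Reduces the invariant to single cells of an arbitrary store, so both branches
    can be checked after symbolic execution.\<close>
  have goal: "scanned i (Suc j) s'"
    if "input_kept s'" "fst s' 4 0 = i" "fst s' 5 0 = Suc j" "fst s' 6 0 = Suc (offset i + j)"
      "fst s' 2 0 = fst s 2 0"
      "snd s' 4 0 = snd s 4 0 + (block_value (Suc i) (Suc j) - block_value (Suc i) j)"
      "snd s' 5 0 = 1 - z - filled (x (Suc i)) z (Suc j)"
      "\<forall>k<i. fst s' 3 k = fst s 3 k"
      "fst s' 3 i = (if x (Suc i) (Suc j) < r then j + 2 else fst s 3 i)" for s'
    using that s i j csf by (simp add: scanned_def)
  have kept: "input_kept s" using s by (simp add: scanned_def)
  show ?thesis
  proof (cases "x (Suc i) (Suc j) < r")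
    case True
    then show ?thesis using j kept
      by (simp add: scan_body_def take_all_def runs_simps st)
        (intro goal; simp add: input_kept_def fill val st)
  next
    case False
    then show ?thesis using j kept
      by (simp add: scan_body_def take_rest_def runs_simps st)
        (intro goal; simp add: input_kept_def fill val st)
  qed
qed

text \<open>The position does not move, because
  \<open>offset (Suc i) = offset i + p (Suc i)\<close>; quota and candidate are reset for the next
  block.\<close>

lemma scan_next:
  assumes s: "scanned i (p (Suc i)) s" and i: "i < \<tau>"
  shows "runs scan_body s (\<lambda>t s'. t \<le> 90 \<and> scanned (Suc i) 0 s')"
proof -
  have blk': "block (p (Suc i)) (w 1 (Suc i)) (w 2 (Suc i)) (x (Suc i)) z"
    using i by (intro blk) auto
  have crit: "critical (p (Suc i)) (x (Suc i)) z (fst s 3 i)"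
    using block.critical_so_far_all[OF blk'] s by (simp add: scanned_def)
  have st: "fst s 4 0 = i" "fst s 5 0 = p (Suc i)" "fst s (Suc 0) i = p (Suc i)" "snd s 0 3 = z"
    using s i by (auto simp: scanned_def input_kept_def)
  have goal: "scanned (Suc i) 0 s'"
    if "input_kept s'" "fst s' 4 0 = Suc i" "fst s' 5 0 = 0" "fst s' 6 0 = fst s 6 0"
      "fst s' 2 0 = fst s 2 0" "snd s' 4 0 = snd s 4 0" "snd s' 5 0 = 1 - z"
      "\<forall>k<Suc i. fst s' 3 k = fst s 3 k" "fst s' 3 (Suc i) = 1" for s'
    using that s i z_mem crit
    by (auto simp: scanned_def filled_def critical_so_far_def offset_def block_value_def
        greedy_value_def less_Suc_eq)
  have kept: "input_kept s" using s by (simp add: scanned_def)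
  then show ?thesis
    by (simp add: scan_body_def runs_simps st)
      (intro goal; simp add: input_kept_def st)
qed

lemma scan_step:
  assumes s: "scanned i j s" and i: "i < \<tau>"
  shows "runs scan_body s (\<lambda>t s'. (\<exists>i j. scanned i j s') \<and> 
    potential s' + t + bcost blocks_left + 1 \<le> potential s)"
proof (cases "j < p (Suc i)")
  case j: True
  \<comment> \<open>Strictness ensures that the truncated subtraction in \<open>potential\<close>
    really drops.\<close>
  have "offset i + j < offset \<tau>"
    using offset_less[of i \<tau> j p] i j by (simp add: offset_def)
  then have "potential s' + 100 \<le> potential s" if "scanned i (Suc j) s'" for s'
    using s that by (auto simp: potential_def scanned_def)
  then show ?thesis
    by (intro runs_mono[OF scan_entry[OF s i j]]) fastforce
next
  case False
  then have j: "j = p (Suc i)" using s i by (simp add: scanned_def)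
  have "potential s' + 100 \<le> potential s" if "scanned (Suc i) 0 s'" for s'
    using s i that by (simp add: potential_def scanned_def offset_def j)
  then show ?thesis
    using s by (intro runs_mono[OF scan_next[OF _ i]]) (fastforce simp: j)+
qed

lemma scanned_start:
  assumes "input_kept s" "fst s 4 0 = 0" "fst s 5 0 = 0" "fst s 6 0 = 0" "fst s 2 0 = 0"
    "snd s 4 0 = 0" "snd s 5 0 = 1 - z" "fst s 3 0 = 1"
  shows "scanned 0 0 s"
  using assms z_mem
  by (simp add: scanned_def offset_def block_value_def greedy_value_def filled_def critical_so_far_def)

lemma input_kept_input_store: "input_kept (input_store \<tau> p w b x y z)"
proof -
  have "snd (input_store \<tau> p w b x y z) 1 = nth_default 0 (flatten \<tau> p (w 1))"
    "snd (input_store \<tau> p w b x y z) 2 = nth_default 0 (flatten \<tau> p (w 2))"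
    "snd (input_store \<tau> p w b x y z) 3 = nth_default 0 (flatten \<tau> p x)"
    by (simp_all add: input_store_def nth_default_def[of "[]"])
  moreover have "snd (input_store \<tau> p w b x y z) 0 = nth_default 0 [b 1, b 2, y, z]"
    "fst (input_store \<tau> p w b x y z) 0 = nth_default 0 [\<tau>]"
    "fst (input_store \<tau> p w b x y z) 1 = nth_default 0 (map p [1..<\<tau> + 1])"
    by (simp_all add: input_store_def nth_default_def[of "[]"])
  ultimately show ?thesis
    unfolding input_kept_def offset_def using nth_flatten
    by (simp add: nth_default_def[of _ "_ # _"] nth_default_def[of _ "map _ _"] del: upt_Suc)
qed

text \<open>A simplex with a point has at least one coordinate. This absorbs the
  \<open>\<tau>\<close> block changes into a bound linear in the number of entries.\<close>

lemma offset_ge: "\<tau> \<le> offset \<tau>"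
proof -
  have "(\<Sum>k=1..\<tau>. 1) \<le> (\<Sum>k=1..\<tau>. p k)"
    using block.p_pos[OF blk] by (intro sum_mono) (simp add: Suc_le_eq)
  then show ?thesis by (simp add: offset_def)
qed

text \<open>Each critical index minimises the bound of its block and blocks are chosen
  independently, so \<open>J\<close> minimises the total; comparing that with \<open>y\<close>
  settles the whole family.\<close>

lemma separation_answer_scanned:
  assumes s: "scanned \<tau> 0 s"
    and out: "fst s' 3 = fst s 3"
      "fst s' 2 0 = (if snd s 4 0 + ((b 1 - b 2) * z + b 2) < y then 1 else 0)"
  shows "separation_answer \<tau> p w b x y z s'"
proof -
  define J where "J = output_selection \<tau> s'"
  have crit: "critical (p i) (x i) z (J i)" if "i \<in> {1..\<tau>}" for i
  proof -
    have "i - 1 < \<tau>" "Suc (i - 1) = i" using that by auto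
    then show ?thesis using s out(1) that unfolding scanned_def J_def output_selection_def by force
  qed
  have J: "J \<in> selections \<tau> p"
    using crit by (auto simp: selections_def critical_def J_def output_selection_def)
  have "snd s 4 0 = (\<Sum>i=1..\<tau>. block_bound (p i) (w 1 i) (w 2 i) (x i) z (J i))"
    using s block.block_bound_critical[OF blk crit]
    by (simp add: scanned_def block_value_def greedy_value_def)
  then have J_bound: "selection_bound \<tau> p w b x z J = snd s 4 0 + ((b 1 - b 2) * z + b 2)"
    by (simp add: selection_bound_blocks)
  have J_min: "selection_bound \<tau> p w b x z J \<le> selection_bound \<tau> p w b x z J'"
    if "J' \<in> selections \<tau> p" for J'
    unfolding selection_bound_blocks
  proof (intro add_right_mono sum_mono)
    fix i assume i: "i \<in> {1..\<tau>}"
    then have "J' i \<in> {1..p i}" using that by (auto simp: selections_def)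
    then show "block_bound (p i) (w 1 i) (w 2 i) (x i) z (J i) \<le> block_bound (p i) (w 1 i) (w 2 i) (x i) z (J' i)"
      using block.block_bound_critical[OF blk crit, OF i i]
        block.greedy_value_le_block_bound[OF blk[OF i]] by simp
  qed
  show ?thesis
  proof (cases "selection_bound \<tau> p w b x z J < y")
    case True
    then have "most_violated \<tau> p w b x y z J"
      using J J_min by (simp add: most_violated_def)
    moreover have "output_violated s' = 1"
      using True out(2) unfolding output_violated_def J_bound by simp
    ultimately show ?thesis by (simp add: separation_answer_def J_def)
  next
    case False
    then have "y \<le> selection_bound \<tau> p w b x z J'" if "J' \<in> selections \<tau> p" for J'
      using J_min[OF that] by linarith
    then show ?thesis
      using False out(2) by (simp add: separation_answer_def output_violated_def J_bound)
  qed
qed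

lemma separation_program_correct:
  "runs separation_program (input_store \<tau> p w b x y z)
     (\<lambda>t s. t \<le> 200 * (\<Sum>i=1..\<tau>. p i) + 100 \<and> separation_answer \<tau> p w b x y z s)"
proof -
  define s0 where "s0 = input_store \<tau> p w b x y z"
  define s1 where "s1 = ((fst s0)(3 := (fst s0 3)(0 := 1)), (snd s0)(5 := (snd s0 5)(0 := 1 - z)))"
  \<comment> \<open>Arrays beyond the input are empty lists; their default 0 initialises counters,
    accumulator and answer.\<close>
  have zero: "fst s0 4 0 = 0" "fst s0 5 0 = 0" "fst s0 6 0 = 0" "fst s0 2 0 = 0" "snd s0 4 0 = 0"
    by (simp_all add: s0_def input_store_def nth_default_def)
  have kept: "input_kept s0" unfolding s0_def by (rule input_kept_input_store)
  have s1: "scanned 0 0 s1"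
    using kept zero by (intro scanned_start) (auto simp: s1_def input_kept_def)
  have "runs (Loop blocks_left scan_body) s1
    (\<lambda>t s. (\<exists>i j. scanned i j s) \<and> \<not> bval blocks_left s \<and>
      t \<le> potential s1 + bcost blocks_left + 1)"
  proof (rule runs_Loop)
    show "\<exists>i j. scanned i j s1" using s1 by blast
  next
    fix s assume "\<exists>i j. scanned i j s" and b: "bval blocks_left s"
    then obtain i j where s: "scanned i j s" by blast
    then have "i < \<tau>" using b by (simp add: scanned_def input_kept_def)
    with s show "runs scan_body s (\<lambda>t s'. (\<exists>i j. scanned i j s') \<and>
        potential s' + t + bcost blocks_left + 1 \<le> potential s)"
      by (rule scan_step)
  qed
  then have loop: "runs (Loop blocks_left scan_body) s1
    (\<lambda>t s. scanned \<tau> 0 s \<and> t \<le> 200 * offset \<tau> + 6)"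
  proof (rule runs_mono, elim conjE exE)
    fix t s i j assume "scanned i j s" "\<not> bval blocks_left s"
      and t: "t \<le> potential s1 + bcost blocks_left + 1"
    \<comment> \<open>The exit test gives \<open>\<tau> \<le> i\<close>, so
      \<open>i = \<tau>\<close>, and there the invariant forces \<open>j = 0\<close>.\<close>
    then have "scanned \<tau> 0 s" by (auto simp: scanned_def input_kept_def split: if_splits)
    moreover have "potential s1 = 100 * (\<tau> + offset \<tau>)"
      using s1 by (simp add: potential_def scanned_def offset_def)
    ultimately show "scanned \<tau> 0 s \<and> t \<le> 200 * offset \<tau> + 6"
      using t offset_ge by simp
  qed
  have report: "runs report s (\<lambda>t s'. t \<le> 30 \<and> separation_answer \<tau> p w b x y z s')"
    if s: "scanned \<tau> 0 s" for s
  proof -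
    have "snd s 0 0 = b 1" "snd s 0 (Suc 0) = b 2" "snd s 0 2 = y" "snd s 0 3 = z" "fst s 2 0 = 0"
      using s by (auto simp: scanned_def input_kept_def)
    then show ?thesis
      by (simp add: report_def runs_simps separation_answer_scanned[OF s])
  qed
  have "runs (Seq (Loop blocks_left scan_body) report) s1
      (\<lambda>t s'. t \<le> 200 * offset \<tau> + 36 \<and> separation_answer \<tau> p w b x y z s')"
    unfolding runs_Seq by (intro runs_mono[OF loop]) (use report in \<open>fastforce elim!: runs_mono\<close>)
  moreover have "snd s0 0 3 = z" using kept by (simp add: input_kept_def)
  ultimately show ?thesis
    unfolding separation_program_def s0_def[symmetric] runs_Seq[of "NStore _ _ _"]
      runs_Seq[of "RStore _ _ _"] runs_NStore runs_RStore
    by (auto simp: s1_def offset_def elim!: runs_mono)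
qed

end

theorem corollary2:
  "(\<forall>(\<tau>::nat) (p::nat \<Rightarrow> nat) (w::nat \<Rightarrow> nat \<Rightarrow> nat \<Rightarrow> real) (b::nat \<Rightarrow> real).
      weights_sorted \<tau> p w \<longrightarrow>
      (\<forall>x\<in>simplex_product \<tau> p. \<forall>y::real. \<forall>z\<in>std_simplex 2.
         (\<forall>\<alpha>\<in>block_vectors \<tau> p. y \<le> dual_bound \<tau> p w b x z \<alpha>) \<longleftrightarrow>
         (\<forall>J\<in>selections \<tau> p. y \<le> selection_bound \<tau> p w b x (z 1) J)))
   \<and>
   (\<exists>(prog::com) (T::nat \<Rightarrow> nat).
      (\<lambda>\<eta>. real (T \<eta>)) \<in> O(\<lambda>\<eta>. real \<eta>) \<and>
      (\<forall>(\<tau>::nat) (p::nat \<Rightarrow> nat) (w::nat \<Rightarrow> nat \<Rightarrow> nat \<Rightarrow> real) (b::nat \<Rightarrow> real).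
         weights_sorted \<tau> p w \<longrightarrow>
         (\<forall>x\<in>simplex_product \<tau> p. \<forall>y::real. \<forall>z\<in>{0..1::real}.
            \<exists>t s. exec prog (input_store \<tau> p w b x y z) t s \<and>
                  t \<le> T (\<Sum>i=1..\<tau>. p i) \<and>
                  separation_answer \<tau> p w b x y z s)))"
proof (intro conjI)
  show "\<forall>(\<tau>::nat) (p::nat \<Rightarrow> nat) (w::nat \<Rightarrow> nat \<Rightarrow> nat \<Rightarrow> real) (b::nat \<Rightarrow> real).
      weights_sorted \<tau> p w \<longrightarrow>
      (\<forall>x\<in>simplex_product \<tau> p. \<forall>y::real. \<forall>z\<in>std_simplex 2.
         (\<forall>\<alpha>\<in>block_vectors \<tau> p. y \<le> dual_bound \<tau> p w b x z \<alpha>) \<longleftrightarrow>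
         (\<forall>J\<in>selections \<tau> p. y \<le> selection_bound \<tau> p w b x (z 1) J))"
    using dual_iff_selections by blast
next
  define T :: "nat \<Rightarrow> nat" where "T \<eta> = 200 * \<eta> + 100" for \<eta>
  have "(\<lambda>\<eta>. real (T \<eta>)) \<in> O(\<lambda>\<eta>. real \<eta>)"
    \<comment> \<open>From \<open>\<eta> \<ge> 1\<close> on,
      \<open>200 * \<eta> + 100 \<le> 300 * \<eta>\<close>.\<close>
    using eventually_ge_at_top[of "1::nat"]
    by (intro bigoI[of _ 300]) (auto simp: T_def elim!: eventually_mono)
  moreover have "\<exists>t s. exec separation_program (input_store \<tau> p w b x y z) t s \<and>
      t \<le> T (\<Sum>i=1..\<tau>. p i) \<and> separation_answer \<tau> p w b x y z s"
    if "weights_sorted \<tau> p w" "x \<in> simplex_product \<tau> p" "z \<in> {0..1}" for \<tau> p w b x y z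
    using separation.separation_program_correct[OF separation.intro[OF that]]
    unfolding runs_def T_def .
  ultimately show "\<exists>(prog::com) (T::nat \<Rightarrow> nat).
      (\<lambda>\<eta>. real (T \<eta>)) \<in> O(\<lambda>\<eta>. real \<eta>) \<and>
      (\<forall>(\<tau>::nat) (p::nat \<Rightarrow> nat) (w::nat \<Rightarrow> nat \<Rightarrow> nat \<Rightarrow> real) (b::nat \<Rightarrow> real).
         weights_sorted \<tau> p w \<longrightarrow>
         (\<forall>x\<in>simplex_product \<tau> p. \<forall>y::real. \<forall>z\<in>{0..1::real}.
            \<exists>t s. exec prog (input_store \<tau> p w b x y z) t s \<and>
                  t \<le> T (\<Sum>i=1..\<tau>. p i) \<and>
                  separation_answer \<tau> p w b x y z s))"
    by blast
qed

end
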